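(* Algorithm Double Proposal is strategy-proof for residents. That is, for every instance $I$ of HRT-MSLQ, every resident $r$ of $I$ with preference $\succeq_r$ in $I$, and every instance $I'$ obtained from $I$ by replacing the preference list $\succeq_r$ of $r$ by some other complete preference list $\succeq_r'$ (possibly with ties), if $M$ and $M'$ denote the outputs of Double Proposal on $I$ and $I'$ respectively, then $M(r)\succeq_r M'(r)$.
   Context: Problem. An instance $I$ of HRT-MSLQ consists of a set $R=\{r_1,\dots,r_n\}$ of residents ($n\ge 1$) and a set $H=\{h_1,\dots,h_m\}$ of hospitals (agents are indexed). Each resident $r$ has a complete preference list over $H$ that may contain ties (a total preorder $\succeq_r$; $\succ_r$ is strict preference, $=_r$ indifference), and each hospital $h$ likewise has a complete preference list over $R$ that may contain ties. Each hospital $h$ has an integer lower quota $\ell(h)$ and upper quota $u(h)$ with $0\le \ell(h)\le u(h)\le n$, $u(h)\ge 1$. Standing assumption: $|R|<\sum_{h\in H}u(h)$. An assignment is a set $M\subseteq R\times H$; $M(r)=\{h:(r,h)\in M\}$, $M(h)=\{r:(r,h)\in M\}$. $M$ is a matching if $|M(r)|\le 1$ for all $r$ and $|M(h)|\le u(h)$ for all $h$; then $M(r)$ also denotes the unique hospital of a matched resident $r$. Algorithm Double Proposal (deterministic). Regard a hospital not in any tie of a resident's list as a tie of length one. Start with $M:=\emptyset$. While some resident is unmatched in $M$: let $r$ be the unmatched resident with smallest index and $T$ the top tie of $r$'s current list. If $T$ contains a hospital to which $r$ has not yet proposed, let $h$ be such a hospital with minimum $\ell(h)$; otherwise let $h$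 be a hospital in $T$ with minimum $\ell(h)$ (in both cases break remaining ties by smallest hospital index). Resident $r$ proposes to $h$, and then: (1) if $|M(h)|<\ell(h)$, set $M:=M\cup\{(r,h)\}$; (2) else, if some resident in $M(h)\cup\{r\}$ has not been rejected by $h$ so far, let $r'$ be the one among such residents with the largest index (possibly $r'=r$) and set $M:=(M\cup\{(r,h)\})\setminus\{(r',h)\}$; (3) else, if $|M(h)|<u(h)$, set $M:=M\cup\{(r,h)\}$; (4) else, let $r'$ be a resident in $M(h)\cup\{r\}$ that is worst for $h$ (the one with largest index if there are several; possibly $r'=r$), set $M:=(M\cup\{(r,h)\})\setminus\{(r',h)\}$, and delete $h$ from the list of $r'$. In (2) and (4), $r'$ is said to be rejected by $h$. When no resident is unmatched, output $M$. (The output is a matching in which every resident is matched.) *)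

theory Defs
  imports Main "HOL-Library.While_Combinator"
begin

text \<open>
  Residents and hospitals are both identified with their indices. In \<open>res_pref I r\<close>, a pair
  \<open>(h, h')\<close> means that \<open>r\<close> weakly prefers \<open>h\<close> to \<open>h'\<close> (the larger element, in the sense of the
  preference, comes first); likewise for \<open>hosp_pref I h\<close>.
\<close>

record hrt_instance =
  num_res :: nat
  num_hosp :: nat
  res_pref :: "nat \<Rightarrow> (nat \<times> nat) set"
  hosp_pref :: "nat \<Rightarrow> (nat \<times> nat) set"
  lower :: "nat \<Rightarrow> nat"
  upper :: "nat \<Rightarrow> nat"

definition residents :: "hrt_instance \<Rightarrow> nat set" where
  "residents I = {1..num_res I}"

definition hospitals :: "hrt_instance \<Rightarrow> nat set" where
  "hospitals I = {1..num_hosp I}"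

definition preference_list :: "nat set \<Rightarrow> (nat \<times> nat) set \<Rightarrow> bool" where
  "preference_list A P \<longleftrightarrow> preorder_on A P \<and> total_on A P"

definition hrt_mslq :: "hrt_instance \<Rightarrow> bool" where
  "hrt_mslq I \<longleftrightarrow>
     num_res I \<ge> 1 \<and>
     (\<forall>r\<in>residents I. preference_list (hospitals I) (res_pref I r)) \<and>
     (\<forall>h\<in>hospitals I. preference_list (residents I) (hosp_pref I h)) \<and>
     (\<forall>h\<in>hospitals I. lower I h \<le> upper I h \<and> upper I h \<le> num_res I \<and> upper I h \<ge> 1) \<and>
     card (residents I) < (\<Sum>h\<in>hospitals I. upper I h)"

definition hospitals_of :: "(nat \<times> nat) set \<Rightarrow> nat \<Rightarrow> nat set" where
  "hospitals_of M r = {h. (r, h) \<in> M}"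

definition residents_of :: "(nat \<times> nat) set \<Rightarrow> nat \<Rightarrow> nat set" where
  "residents_of M h = {r. (r, h) \<in> M}"

text \<open>
  A state consists of the current assignment and the history of the run. All four components are
  sets of pairs (resident, hospital): the resident has proposed to the hospital, has been rejected
  by it, or has had it deleted from his or her list.
\<close>

record state =
  asg :: "(nat \<times> nat) set"
  proposed :: "(nat \<times> nat) set"
  rejected :: "(nat \<times> nat) set"
  deleted :: "(nat \<times> nat) set"

definition init_state :: state where
  "init_state = \<lparr>asg = {}, proposed = {}, rejected = {}, deleted = {}\<rparr>"

definition unmatched :: "hrt_instance \<Rightarrow> state \<Rightarrow> nat set" where
  "unmatched I s = {r \<in> residents I. hospitals_of (asg s) r = {}}"

definition current_list :: "hrt_instance \<Rightarrow> state \<Rightarrow> nat \<Rightarrow> nat set" where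
  "current_list I s r = {h \<in> hospitals I. (r, h) \<notin> deleted s}"

definition top_tie :: "hrt_instance \<Rightarrow> state \<Rightarrow> nat \<Rightarrow> nat set" where
  "top_tie I s r =
     {h \<in> current_list I s r. \<forall>h'\<in>current_list I s r. (h, h') \<in> res_pref I r}"

text \<open>
  Here and below, \<open>Min\<close> and \<open>Max\<close> over sets of agents do the tie-breaking by index. They are only
  meant for nonempty sets; that no resident's list ever runs empty is a consequence of
  \<open>card (residents I) < (\<Sum>h\<in>hospitals I. upper I h)\<close>.
\<close>

definition min_lower :: "hrt_instance \<Rightarrow> nat set \<Rightarrow> nat" where
  "min_lower I C = Min {h \<in> C. \<forall>h'\<in>C. lower I h \<le> lower I h'}"

definition proposal_target :: "hrt_instance \<Rightarrow> state \<Rightarrow> nat \<Rightarrow> nat" where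
  "proposal_target I s r =
     (let T = top_tie I s r; N = {h \<in> T. (r, h) \<notin> proposed s}
      in if N \<noteq> {} then min_lower I N else min_lower I T)"

definition worst :: "hrt_instance \<Rightarrow> nat \<Rightarrow> nat set \<Rightarrow> nat" where
  "worst I h A = Max {r \<in> A. \<forall>r'\<in>A. (r', r) \<in> hosp_pref I h}"

text \<open>The reaction of hospital \<open>h\<close> to a proposal by \<open>r\<close>.\<close>

definition respond :: "hrt_instance \<Rightarrow> nat \<Rightarrow> nat \<Rightarrow> state \<Rightarrow> state" where
  "respond I r h s =
     (let M = asg s;
          A = residents_of M h \<union> {r};
          N = {r' \<in> A. (r', h) \<notin> rejected s}
      in
        if card (residents_of M h) < lower I h then
          s\<lparr>asg := M \<union> {(r, h)}\<rparr>
        else if N \<noteq> {} then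
          (let r' = Max N
           in s\<lparr>asg := (M \<union> {(r, h)}) - {(r', h)},
                rejected := rejected s \<union> {(r', h)}\<rparr>)
        else if card (residents_of M h) < upper I h then
          s\<lparr>asg := M \<union> {(r, h)}\<rparr>
        else
          (let r' = worst I h A
           in s\<lparr>asg := (M \<union> {(r, h)}) - {(r', h)},
                rejected := rejected s \<union> {(r', h)},
                deleted := deleted s \<union> {(r', h)}\<rparr>))"

definition dp_step :: "hrt_instance \<Rightarrow> state \<Rightarrow> state" where
  "dp_step I s =
     (let r = Min (unmatched I s);
          h = proposal_target I s r
      in respond I r h (s\<lparr>proposed := proposed s \<union> {(r, h)}\<rparr>))"

text \<open>
  \<open>None\<close> would mean that the loop never ends.
\<close>

definition double_proposal :: "hrt_instance \<Rightarrow> (nat \<times> nat) set option" where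
  "double_proposal I =
     map_option asg (while_option (\<lambda>s. unmatched I s \<noteq> {}) (dp_step I) init_state)"

end

(*
  Split every possible assignment of a resident to a hospital into two contracts, the first and the
  second proposal.  Ties and the two rounds of proposals then turn each resident's list into a strict
  order of contracts (better), in which a preferred contract never has a strictly worse hospital, and
  a hospital's reactions become a choice function of the cumulative set of offers that is
  substitutable (refused_mono) and satisfies the law of aggregate demand (card_held_mono).  By
  substitutability the offers made during a run are the least fixed point of "offer a contract once
  all better ones are refused", so the order of proposals is irrelevant.

  Suppose a resident r gets y by lying but only something worse than y when truthful.  Shrink r's
  list to y alone: this makes fewer offers than the lie, so r still gets y.  Truncate r's true list
  after y: r stays unmatched, and the offers of the shrunken list are among those of the truncated
  one.  Hence every resident matched in the truncated run is matched in the shrunken one, as is r,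
  so the larger set of offers has strictly fewer contracts held, against the law of aggregate
  demand.
*)
theory Submission
  imports Defs
begin

section \<open>Initial segments of finite strict linear orders\<close>

text \<open>The \<open>k\<close> first elements of \<open>A\<close> under \<open>lt\<close>,
  described by counting predecessors rather than by sorting, so that the effect of changing
  \<open>A\<close> or \<open>k\<close> can be read off cardinalities.\<close>

definition initial :: "('a \<Rightarrow> 'a \<Rightarrow> bool) \<Rightarrow> nat \<Rightarrow> 'a set \<Rightarrow> 'a set" where
  "initial lt k A = {a \<in> A. card {b \<in> A. lt b a} < k}"

lemma initial_subset: "initial lt k A \<subseteq> A"
  by (auto simp: initial_def)

lemma initial_0 [simp]: "initial lt 0 A = {}"
  by (simp add: initial_def)

text \<open>A smaller set leaves \<open>a\<close> no more predecessors, and a larger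
  \<open>k\<close> only helps. This is the source of substitutability.\<close>

lemma initial_antimono:
  assumes "a \<in> initial lt k' B" "A \<subseteq> B" "finite B" "k' \<le> k" "a \<in> A"
  shows "a \<in> initial lt k A"
proof -
  have "card {b \<in> A. lt b a} \<le> card {b \<in> B. lt b a}"
    by (rule card_mono) (use assms in auto)
  with assms show ?thesis by (auto simp: initial_def)
qed

definition strict_linear_on :: "'a set \<Rightarrow> ('a \<Rightarrow> 'a \<Rightarrow> bool) \<Rightarrow> bool" where
  "strict_linear_on A lt \<longleftrightarrow> irreflp_on A lt \<and> transp_on A lt \<and> totalp_on A lt"

lemma strict_linear_on_subset:
  "strict_linear_on B lt \<Longrightarrow> A \<subseteq> B \<Longrightarrow> strict_linear_on A lt"
  unfolding strict_linear_on_def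
  by (meson irreflp_on_subset transp_on_subset totalp_on_subset)

lemma strict_linear_on_less: "strict_linear_on A ((<) :: 'a::linorder \<Rightarrow> 'a \<Rightarrow> bool)"
  by (auto simp: strict_linear_on_def irreflp_on_def transp_on_def totalp_on_def)

context
  fixes A :: "'a set" and lt :: "'a \<Rightarrow> 'a \<Rightarrow> bool"
  assumes fin: "finite A" and lin: "strict_linear_on A lt"
begin

lemma strict_linear_irrefl: "a \<in> A \<Longrightarrow> \<not> lt a a"
  using lin by (auto simp: strict_linear_on_def irreflp_on_def)

lemma strict_linear_trans: "lt a b \<Longrightarrow> lt b c \<Longrightarrow> a \<in> A \<Longrightarrow> b \<in> A \<Longrightarrow> c \<in> A \<Longrightarrow> lt a c"
  using lin unfolding strict_linear_on_def transp_on_def by blast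

lemma strict_linear_total: "a \<in> A \<Longrightarrow> b \<in> A \<Longrightarrow> a \<noteq> b \<Longrightarrow> lt a b \<or> lt b a"
  using lin unfolding strict_linear_on_def totalp_on_def by blast

lemma strict_linear_asym: "lt a b \<Longrightarrow> a \<in> A \<Longrightarrow> b \<in> A \<Longrightarrow> \<not> lt b a"
  using strict_linear_trans[of a b a] strict_linear_irrefl by blast

lemma rank_less:
  assumes "a \<in> A" "b \<in> A" "lt a b"
  shows "card {x \<in> A. lt x a} < card {x \<in> A. lt x b}"
proof (rule psubset_card_mono)
  show "finite {x \<in> A. lt x b}" using fin by simp
  have "a \<in> {x \<in> A. lt x b}" "a \<notin> {x \<in> A. lt x a}" using assms strict_linear_irrefl by auto
  moreover have "{x \<in> A. lt x a} \<subseteq> {x \<in> A. lt x b}"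
    using strict_linear_trans[OF _ assms(3)] assms by blast
  ultimately show "{x \<in> A. lt x a} \<subset> {x \<in> A. lt x b}" by blast
qed

text \<open>The rank maps \<open>A\<close> injectively into \<open>{..<card A}\<close>, hence onto
  it, so exactly \<open>min (card A) k\<close> elements have rank below \<open>k\<close>.\<close>

lemma card_initial: "card (initial lt k A) = min (card A) k"
proof -
  let ?rk = "\<lambda>a. card {x \<in> A. lt x a}"
  have inj: "inj_on ?rk A"
  proof (rule inj_onI, rule ccontr)
    fix a b assume ab: "a \<in> A" "b \<in> A" "?rk a = ?rk b" "a \<noteq> b"
    then consider "lt a b" | "lt b a" using strict_linear_total by blast
    then show False using ab rank_less by cases force+
  qed
  have "?rk ` A \<subseteq> {..<card A}"
  proof
    fix i assume "i \<in> ?rk ` A"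
    then obtain a where a: "a \<in> A" "i = ?rk a" by blast
    have "{x \<in> A. lt x a} \<subset> A" using a strict_linear_irrefl by blast
    then show "i \<in> {..<card A}" using psubset_card_mono[OF fin] a(2) by simp
  qed
  then have im: "?rk ` A = {..<card A}"
    by (rule card_subset_eq[rotated]) (simp_all add: card_image[OF inj])
  have "?rk ` initial lt k A = {i \<in> ?rk ` A. i < k}"
    by (auto simp: initial_def)
  also have "\<dots> = {..<min (card A) k}" using im by auto
  finally have "card (?rk ` initial lt k A) = min (card A) k" by simp
  moreover have "inj_on ?rk (initial lt k A)"
    using inj initial_subset by (rule inj_on_subset)
  ultimately show ?thesis by (simp add: card_image)
qed

lemma initial_before:
  assumes "b \<in> initial lt k A" "a \<in> A - initial lt k A"
  shows "lt b a"
proof (rule ccontr)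
  assume "\<not> lt b a"
  then have "lt a b" using assms strict_linear_total[of a b] initial_subset[of lt k A] by blast
  then have "card {x \<in> A. lt x a} < card {x \<in> A. lt x b}"
    using assms initial_subset[of lt k A] by (intro rank_less) blast+
  with assms show False by (auto simp: initial_def)
qed

text \<open>The predecessors of an element of \<open>B\<close> lie in \<open>B\<close>, so its rank
  is below \<open>card B\<close>; equal cardinalities then identify the two sets. Segments are
  recognised in this way after an update.\<close>

lemma initial_unique:
  assumes B: "B \<subseteq> A" "card B = min (card A) k"
    and below: "\<And>a b. b \<in> B \<Longrightarrow> a \<in> A - B \<Longrightarrow> lt b a"
  shows "initial lt k A = B"
proof -
  have finB: "finite B" using B fin finite_subset by blast
  have "B \<subseteq> initial lt k A"
  proof
    fix b assume b: "b \<in> B"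
    have "{x \<in> A. lt x b} \<subset> B"
    proof
      show "{x \<in> A. lt x b} \<subseteq> B"
        using below[OF b] b B(1) strict_linear_irrefl[OF subsetD[OF B(1) b]] strict_linear_asym by blast
      show "{x \<in> A. lt x b} \<noteq> B" using b B(1) strict_linear_irrefl by blast
    qed
    then have "card {x \<in> A. lt x b} < card B" using finB psubset_card_mono by blast
    then show "b \<in> initial lt k A" using b B by (auto simp: initial_def)
  qed
  moreover have "card B = card (initial lt k A)" using B(2) card_initial by simp
  moreover have "finite (initial lt k A)" using finite_subset[OF initial_subset fin] by blast
  ultimately show ?thesis using card_subset_eq by metis
qed

lemma initial_all: "card A \<le> k \<Longrightarrow> initial lt k A = A"
  by (rule initial_unique) simp_all

lemma initial_pred:
  assumes k: "0 < k" "k \<le> card A" and w: "w \<in> initial lt k A"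
    and last: "\<And>x. x \<in> initial lt k A \<Longrightarrow> x \<noteq> w \<Longrightarrow> lt x w"
  shows "initial lt (k - 1) A = initial lt k A - {w}"
proof (rule initial_unique)
  show "initial lt k A - {w} \<subseteq> A" using initial_subset[of lt k A] by blast
  show "card (initial lt k A - {w}) = min (card A) (k - 1)"
    unfolding card_Diff_singleton[OF w] card_initial using k by simp
  show "lt b a" if "b \<in> initial lt k A - {w}" "a \<in> A - (initial lt k A - {w})" for a b
    using that last[of b] initial_before[of b k a] by (cases "a = w") auto
qed

end

text \<open>As \<open>k \<le> card A\<close>, the old segment is full: the newcomer \<open>r\<close>
  competes with it, and exactly one element, the last, loses out (possibly \<open>r\<close>
  itself).\<close>

lemma initial_insert:
  assumes fin: "finite A" and lin: "strict_linear_on (insert r A) lt"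
    and r: "r \<notin> A" and k: "k \<le> card A"
    and w: "w \<in> insert r (initial lt k A)"
    and last: "\<And>x. x \<in> insert r (initial lt k A) \<Longrightarrow> x \<noteq> w \<Longrightarrow> lt x w"
  shows "initial lt k (insert r A) = insert r (initial lt k A) - {w}"
proof (rule initial_unique)
  have linA: "strict_linear_on A lt" using lin strict_linear_on_subset by blast
  note before = initial_before[OF fin linA] and card_i = card_initial[OF fin linA]
  show "finite (insert r A)" using fin by simp
  show "strict_linear_on (insert r A) lt" by (rule lin)
  show "insert r (initial lt k A) - {w} \<subseteq> insert r A" using initial_subset[of lt k A] by blast
  have "r \<notin> initial lt k A" using r initial_subset[of lt k A] by blast
  moreover have "finite (initial lt k A)" using finite_subset[OF initial_subset fin] by blast
  ultimately show "card (insert r (initial lt k A) - {w}) = min (card (insert r A)) k"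
    using w k r fin by (simp add: card_i card_Diff_singleton)
  show "lt b a"
    if b: "b \<in> insert r (initial lt k A) - {w}"
      and a: "a \<in> insert r A - (insert r (initial lt k A) - {w})" for a b
  proof (cases "a = w")
    case True
    then show ?thesis using b last[of b] by blast
  next
    case False
    then have a': "a \<in> A - initial lt k A" using a by blast
    show ?thesis
    proof (cases "b = r")
      case True
      \<comment> \<open>\<open>r\<close> survives only by displacing a member \<open>w\<close> of
        the old segment, which links \<open>r\<close> to the outsider \<open>a\<close>.\<close>
      then have "w \<in> initial lt k A" "lt r w" using w b last[of r] by blast+
      moreover then have "lt w a" using a' before[of w k a] by blast
      ultimately show ?thesis
        using True a' initial_subset[of lt k A] strict_linear_trans[OF _ lin, of r w a] fin by blast
    next
      case False
      then show ?thesis using b a' before[of b k a] by blast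
    qed
  qed
qed


section \<open>Reaction of a single hospital\<close>

text \<open>
  The residents who have proposed (\<open>F\<close>), have been rejected (\<open>R\<close>), are assigned (\<open>M\<close>), or are
  deleted (\<open>D\<close>). An assigned or deleted resident who has been rejected before has proposed twice,
  so \<open>R \<inter> M \<union> D\<close> are the second proposals and \<open>M - R\<close> the first proposals that are still held.
\<close>

definition hosp_inv ::
  "(nat \<Rightarrow> nat \<Rightarrow> bool) \<Rightarrow> nat \<Rightarrow> nat \<Rightarrow> nat set \<Rightarrow> nat set \<Rightarrow> nat set \<Rightarrow> nat set \<Rightarrow> bool"
  where
  "hosp_inv lt l u F R M D \<longleftrightarrow>
     M \<union> R = F \<and> D \<subseteq> R \<and> D \<inter> M = {} \<and>
     initial lt u (R \<inter> M \<union> D) = R \<inter> M \<and>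
     initial (<) (l - card (R \<inter> M \<union> D)) F = M - R"

text \<open>\<open>r\<close> is the next proposer, unassigned and with the hospital still on the
  list. If \<open>r\<close> already lies in \<open>F\<close>, the proposal is a second one.\<close>

locale hospital_state =
  fixes lt :: "nat \<Rightarrow> nat \<Rightarrow> bool" and l u :: nat and F R M D :: "nat set" and r :: nat
  assumes fin: "finite F" and lin: "strict_linear_on (insert r F) lt" and lu: "l \<le> u"
    and inv: "hosp_inv lt l u F R M D" and rM: "r \<notin> M" and rD: "r \<notin> D"
begin

abbreviation S where "S \<equiv> R \<inter> M \<union> D"

lemma F_eq: "F = M \<union> R" and D_sub: "D \<subseteq> R" and D_M: "D \<inter> M = {}"
  and second: "initial lt u S = R \<inter> M" and first: "initial (<) (l - card S) F = M - R"
  using inv by (auto simp: hosp_inv_def)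

lemma S_sub: "S \<subseteq> F" using F_eq D_sub by blast

lemma fin_S: "finite S" using S_sub fin by (rule finite_subset)

lemma lin_S: "strict_linear_on S lt"
  by (rule strict_linear_on_subset[OF lin]) (use S_sub in blast)

lemma card_second: "card (R \<inter> M) = min (card S) u"
  using card_initial[OF fin_S lin_S, of u] second by simp

lemma card_first: "card (M - R) = min (card F) (l - card S)"
  using card_initial[OF fin strict_linear_on_less, of "l - card S"] first by simp

lemma card_M: "card M = min (card S) u + min (card F) (l - card S)"
proof -
  have "finite M" using fin F_eq by simp
  then have "card (R \<inter> M) + card (M - R) = card ((R \<inter> M) \<union> (M - R))"
    by (subst card_Un_disjoint) auto
  also have "(R \<inter> M) \<union> (M - R) = M" by blast
  finally show ?thesis using card_first card_second by simp
qed

lemma not_full_D: assumes "card S \<le> u" shows "D = {}"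
proof -
  have "R \<inter> M = S" using initial_all[OF fin_S lin_S assms] second by simp
  then show ?thesis using D_M by blast
qed

lemma r_in: "r \<in> F \<longleftrightarrow> r \<in> R"
  using F_eq rM by blast

text \<open>Reaction (1). Fewer than \<open>l\<close> assigned residents means that nobody has been
  rejected yet, so \<open>r\<close> proposes for the first time. For all four reactions the second
  conclusion says that the second proposals gain just \<open>r\<close>, and only if \<open>r\<close>
  proposes again.\<close>

lemma accept_below_lower:
  assumes "card M < l"
  shows "hosp_inv lt l u (insert r F) R (insert r M) D"
    and "R \<inter> insert r M \<union> D = (if r \<in> F then insert r S else S)"
proof -
  have "card S < l" "card F < l - card S" using assms card_M lu by linarith+
  then have "F = M - R" using initial_all[OF fin strict_linear_on_less] first by auto
  then have R: "R = {}" using F_eq by blast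
  then have D: "D = {}" using D_sub by blast
  have "r \<notin> F" using R r_in by simp
  have "card (insert r F) \<le> l"
    using \<open>card F < l - card S\<close> \<open>r \<notin> F\<close> fin by simp
  then have "initial (<) l (insert r F) = insert r F"
    using fin strict_linear_on_less by (intro initial_all) auto
  then show "hosp_inv lt l u (insert r F) R (insert r M) D"
    using R D F_eq by (simp add: hosp_inv_def initial_def)
  show "R \<inter> insert r M \<union> D = (if r \<in> F then insert r S else S)"
    using R \<open>r \<notin> F\<close> by simp
qed

text \<open>Reaction (2). The places for first proposals are full. A first proposal by
  \<open>r\<close> competes for them, a second one takes one of them away; either way the last
  candidate by index goes.\<close>

lemma reject_first:
  assumes c: "l \<le> card M" and N: "insert r M - R \<noteq> {}"
  defines "w \<equiv> Max (insert r M - R)"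
  shows "hosp_inv lt l u (insert r F) (insert w R) (insert r M - {w}) D"
    and "insert w R \<inter> (insert r M - {w}) \<union> D = (if r \<in> F then insert r S else S)"
proof -
  have finM: "finite M" using fin F_eq by simp
  have w: "w \<in> insert r M" "w \<notin> R"
    using Max_in[OF _ N] finM by (auto simp: w_def)
  have last: "x < w" if "x \<in> insert r M - R" "x \<noteq> w" for x
  proof -
    have "x \<le> w" unfolding w_def using finM that(1) by (intro Max_ge) auto
    then show ?thesis using that(2) by simp
  qed
  \<comment> \<open>With fewer first proposals than places for them, all would be held and
    \<open>card M < l\<close>.\<close>
  have k: "l - card S \<le> card F" using c card_M lu by linarith
  have "hosp_inv lt l u (insert r F) (insert w R) (insert r M - {w}) D \<and>
    insert w R \<inter> (insert r M - {w}) \<union> D = (if r \<in> F then insert r S else S)"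
  proof (cases "r \<in> F")
    case False
    then have rR: "r \<notin> R" using r_in by blast
    have RM: "insert w R \<inter> (insert r M - {w}) = R \<inter> M" using rR w by blast
    have N_eq: "insert r (initial (<) (l - card S) F) = insert r M - R"
      using first rR by blast
    have "initial (<) (l - card S) (insert r F) = insert r (initial (<) (l - card S) F) - {w}"
      by (rule initial_insert[OF fin strict_linear_on_less False k])
        (use w last in \<open>simp_all only: N_eq Diff_iff simp_thms\<close>)
    also have "\<dots> = (insert r M - {w}) - insert w R" unfolding N_eq by blast
    finally have "initial (<) (l - card S) (insert r F) = (insert r M - {w}) - insert w R" .
    moreover have "(insert r M - {w}) \<union> insert w R = insert r F" using F_eq w by blast
    moreover have "D \<inter> (insert r M - {w}) = {}" using D_M rD by blast
    moreover have "D \<subseteq> insert w R" using D_sub by blast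
    ultimately show ?thesis
      using False second by (simp only: hosp_inv_def RM if_False simp_thms)
  next
    case True
    then have rR: "r \<in> R" using r_in by blast
    have wM: "w \<in> M - R" using w rR by blast
    then have pos: "0 < l - card S" using first by (cases "l - card S") auto
    have S': "insert w R \<inter> (insert r M - {w}) \<union> D = insert r S" using w rR wM by blast
    \<comment> \<open>A place left for first proposals means \<open>card S < l \<le> u\<close>, so
      no second proposal has been refused.\<close>
    have "D = {}" using not_full_D pos lu by simp
    then have RM': "insert w R \<inter> (insert r M - {w}) = insert r S" using S' by blast
    have rS: "r \<notin> S" using rM rD by blast
    then have card': "card (insert r S) = Suc (card S)" using fin_S by simp
    then have "initial lt u (insert r S) = insert r S"
      using pos lu fin_S S_sub True
      by (intro initial_all strict_linear_on_subset[OF lin]) auto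
    moreover have "initial (<) (l - card (insert r S)) F = (insert r M - {w}) - insert w R"
    proof -
      have "initial (<) (l - card S - 1) F = initial (<) (l - card S) F - {w}"
        by (rule initial_pred[OF fin strict_linear_on_less pos k])
          (use wM last in \<open>auto simp only: first\<close>)
      also have "\<dots> = (insert r M - {w}) - insert w R" using first rR by blast
      finally show ?thesis using card' by simp
    qed
    moreover have "(insert r M - {w}) \<union> insert w R = insert r F" using F_eq w by blast
    ultimately show ?thesis
      using \<open>D = {}\<close> RM' True by (simp add: hosp_inv_def insert_absorb[OF True])
  qed
  then show "hosp_inv lt l u (insert r F) (insert w R) (insert r M - {w}) D"
    and "insert w R \<inter> (insert r M - {w}) \<union> D = (if r \<in> F then insert r S else S)"
    by blast+
qed

text \<open>The situation of reactions (3) and (4): only second proposals are held, they use up the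
  lower quota, and \<open>r\<close> proposes again.\<close>

lemma no_first:
  assumes "l \<le> card M" "insert r M - R = {}"
  shows "M \<subseteq> R" "r \<in> F" "card M = min (card S) u" "l \<le> card S" "insert r F = F" "r \<notin> S"
proof -
  show MR: "M \<subseteq> R" "r \<in> F" using assms(2) r_in by auto
  then show M: "card M = min (card S) u" using card_second by (simp add: Int_absorb1)
  show "l \<le> card S" using assms(1) M by simp
  show "insert r F = F" using MR by blast
  show "r \<notin> S" using rM rD by blast
qed

text \<open>Reaction (3). All second proposals, with the new one, fit within \<open>u\<close>, and
  first proposals have no place before or after.\<close>

lemma accept_second:
  assumes "l \<le> card M" "insert r M - R = {}" "card M < u"
  shows "hosp_inv lt l u (insert r F) R (insert r M) D"
    and "R \<inter> insert r M \<union> D = (if r \<in> F then insert r S else S)"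
proof -
  note nf = no_first[OF assms(1,2)]
  have "r \<in> R" using assms(2) by blast
  then show S': "R \<inter> insert r M \<union> D = (if r \<in> F then insert r S else S)" using nf(2) by simp
  have "card S < u" using nf(3) assms(3) by linarith
  then have D: "D = {}" using not_full_D by simp
  have card': "card (insert r S) = Suc (card S)" using fin_S nf(6) by simp
  have "initial lt u (insert r S) = insert r S"
    using \<open>card S < u\<close> card' fin_S S_sub nf(2)
    by (intro initial_all strict_linear_on_subset[OF lin]) auto
  moreover have "R \<inter> insert r M = insert r S" using D \<open>r \<in> R\<close> by blast
  moreover have "l - card (insert r S) = 0" using card' nf(4) by simp
  moreover have "insert r M - R = {}" "insert r M \<union> R = insert r F" using assms(2) F_eq by blast+
  ultimately show "hosp_inv lt l u (insert r F) R (insert r M) D"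
    using D by (simp add: hosp_inv_def)
qed

text \<open>Reaction (4). Second proposals fill all \<open>u\<close> places, so the one by
  \<open>r\<close> displaces the last of them. That \<open>worst\<close> provides such a
  \<open>w\<close> is shown in \<open>worst_last\<close>.\<close>

lemma reject_second:
  assumes "l \<le> card M" "insert r M - R = {}" "u \<le> card M"
    and w: "w \<in> insert r M" "\<And>x. x \<in> insert r M \<Longrightarrow> x \<noteq> w \<Longrightarrow> lt x w"
  shows "hosp_inv lt l u (insert r F) (insert w R) (insert r M - {w}) (insert w D)"
    and "insert w R \<inter> (insert r M - {w}) \<union> insert w D = (if r \<in> F then insert r S else S)"
proof -
  note nf = no_first[OF assms(1,2)]
  have rR: "r \<in> R" using assms(2) by blast
  \<comment> \<open>\<open>w\<close> was rejected before, so only the deletion is new.\<close>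
  have wR: "insert w R = R" using w(1) rR nf(1) by blast
  have RM: "R \<inter> M = M" using nf(1) by blast
  have S': "insert w R \<inter> (insert r M - {w}) \<union> insert w D = insert r S"
    unfolding wR using w(1) rR nf(1) by blast
  then show "insert w R \<inter> (insert r M - {w}) \<union> insert w D = (if r \<in> F then insert r S else S)"
    using nf(2) by simp
  have u: "u \<le> card S" using assms(3) nf(3) by linarith
  have "initial lt u (insert r S) = insert r (initial lt u S) - {w}"
  proof (rule initial_insert[OF fin_S _ nf(6) u])
    show "strict_linear_on (insert r S) lt"
      using S_sub by (intro strict_linear_on_subset[OF lin]) blast
  qed (use w in \<open>simp_all only: trans[OF second RM]\<close>)
  also have "\<dots> = insert w R \<inter> (insert r M - {w})"
    unfolding second wR using nf(1) rR by blast
  finally have "initial lt u (insert r S) = insert w R \<inter> (insert r M - {w})" .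
  moreover have "l - card (insert r S) = 0" using u lu fin_S nf(6) by simp
  moreover have "(insert r M - {w}) - insert w R = {}" using wR assms(2) by blast
  moreover have "(insert r M - {w}) \<union> insert w R = insert r F" using F_eq w(1) by blast
  moreover have "insert w D \<subseteq> insert w R" using D_sub by blast
  moreover have "insert w D \<inter> (insert r M - {w}) = {}" using D_M rD by blast
  ultimately show "hosp_inv lt l u (insert r F) (insert w R) (insert r M - {w}) (insert w D)"
    by (simp only: hosp_inv_def S' initial_0 simp_thms)
qed

end

section \<open>Contracts and cumulative offers\<close>

text \<open>
  A contract \<open>(r, h, k)\<close> stands for the first (\<open>k = False\<close>) or the second (\<open>k = True\<close>) proposal
  of \<open>r\<close> to \<open>h\<close>.
\<close>

type_synonym contract = "nat \<times> nat \<times> bool"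

definition contracts :: "hrt_instance \<Rightarrow> contract set" where
  "contracts I = residents I \<times> hospitals I \<times> UNIV"

text \<open>Ties favour the smaller index because reaction (4) rejects the largest index among the
  worst.\<close>

definition hosp_before :: "hrt_instance \<Rightarrow> nat \<Rightarrow> nat \<Rightarrow> nat \<Rightarrow> bool" where
  "hosp_before I h a b \<longleftrightarrow>
     (a, b) \<in> hosp_pref I h \<and> ((b, a) \<notin> hosp_pref I h \<or> a < b)"

text \<open>The order in which Double Proposal goes through a list: tie by tie, within a tie all
  first proposals before all second ones, within a round by lower quota and then index. On booleans,
  \<open>k < k'\<close> puts \<open>False\<close> first.\<close>

definition better :: "hrt_instance \<Rightarrow> contract \<Rightarrow> contract \<Rightarrow> bool" where
  "better I = (\<lambda>(q, h, k) (q', h', k').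
     q = q' \<and> (h, h') \<in> res_pref I q \<and>
     ((h', h) \<notin> res_pref I q \<or> k < k' \<or>
      k = k' \<and> (lower I h < lower I h' \<or> lower I h = lower I h' \<and> h < h')))"

definition offerers :: "hrt_instance \<Rightarrow> contract set \<Rightarrow> nat \<Rightarrow> bool \<Rightarrow> nat set" where
  "offerers I Y h k = {a \<in> residents I. (a, h, k) \<in> Y}"

text \<open>
  The cumulative choice of a hospital: second proposals compete for all \<open>upper I h\<close> places, and
  first proposals, ordered by index, get what second proposals leave of the first \<open>lower I h\<close>
  places.
\<close>

definition chosen :: "hrt_instance \<Rightarrow> contract set \<Rightarrow> nat \<Rightarrow> bool \<Rightarrow> nat set" where
  "chosen I Y h k =
     (if k then initial (hosp_before I h) (upper I h) (offerers I Y h True)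
      else initial (<) (lower I h - card (offerers I Y h True)) (offerers I Y h False))"

definition held :: "hrt_instance \<Rightarrow> contract set \<Rightarrow> contract set" where
  "held I Y = {(a, h, k) \<in> Y. a \<in> chosen I Y h k}"

definition refused :: "hrt_instance \<Rightarrow> contract set \<Rightarrow> contract set" where
  "refused I Y = Y - held I Y"

definition offer_step :: "hrt_instance \<Rightarrow> contract set \<Rightarrow> contract set \<Rightarrow> contract set" where
  "offer_step I A Y = {c \<in> A. \<forall>d\<in>A. better I d c \<longrightarrow> d \<in> refused I Y}"

text \<open>\<open>A\<close> is the set of contracts that are acceptable to their residents.\<close>

definition offers_made :: "hrt_instance \<Rightarrow> contract set \<Rightarrow> contract set" where
  "offers_made I A = lfp (offer_step I A)"

lemma finite_residents [simp]: "finite (residents I)"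
  by (simp add: residents_def)

lemma finite_hospitals [simp]: "finite (hospitals I)"
  by (simp add: hospitals_def)

lemma finite_contracts [simp]: "finite (contracts I)"
  by (simp add: contracts_def)

lemma finite_offerers [simp]: "finite (offerers I Y h k)"
  by (simp add: offerers_def)

section \<open>Substitutability and the least fixed point of offers\<close>

lemma offerers_mono: "Y \<subseteq> Z \<Longrightarrow> offerers I Y h k \<subseteq> offerers I Z h k"
  by (auto simp: offerers_def)

lemma chosen_antimono:
  assumes YZ: "Y \<subseteq> Z" and a: "a \<in> chosen I Z h k" "(a, h, k) \<in> Y"
  shows "a \<in> chosen I Y h k"
proof -
  have sub: "offerers I Y h k \<subseteq> offerers I Z h k" for k
    using YZ by (rule offerers_mono)
  have "a \<in> residents I"
    using a by (auto simp: chosen_def offerers_def initial_def split: if_splits)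
  then have aY: "a \<in> offerers I Y h k" using a by (simp add: offerers_def)
  show ?thesis
  proof (cases k)
    case True
    then show ?thesis
      using a(1) aY initial_antimono[OF _ sub finite_offerers order_refl] by (simp add: chosen_def)
  next
    case False
    \<comment> \<open>More second proposals leave fewer places to first ones, so additional offers
      of either kind can only hurt a first proposal.\<close>
    have "lower I h - card (offerers I Z h True) \<le> lower I h - card (offerers I Y h True)"
      by (intro diff_le_mono2 card_mono sub finite_offerers)
    then show ?thesis
      using a(1) aY False initial_antimono[OF _ sub finite_offerers] by (simp add: chosen_def)
  qed
qed

lemma held_antimono: "Y \<subseteq> Z \<Longrightarrow> c \<in> held I Z \<Longrightarrow> c \<in> Y \<Longrightarrow> c \<in> held I Y"
  by (cases c) (auto simp: held_def intro: chosen_antimono)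

lemma refused_mono: "Y \<subseteq> Z \<Longrightarrow> refused I Y \<subseteq> refused I Z"
  using held_antimono unfolding refused_def by blast

lemma refused_subset: "refused I Y \<subseteq> Y"
  by (auto simp: refused_def)

lemma offer_step_mono: "mono (offer_step I A)"
proof (rule monoI)
  fix Y Z :: "contract set"
  assume "Y \<subseteq> Z"
  then show "offer_step I A Y \<subseteq> offer_step I A Z"
    using refused_mono[of Y Z I] by (auto simp: offer_step_def)
qed

lemma offers_made_fixpoint: "offer_step I A (offers_made I A) = offers_made I A"
  unfolding offers_made_def by (rule lfp_unfold[OF offer_step_mono, symmetric])

lemma offers_made_least: "offer_step I A Y \<subseteq> Y \<Longrightarrow> offers_made I A \<subseteq> Y"
  unfolding offers_made_def by (rule lfp_lowerbound)

lemma offers_made_iff: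
  "c \<in> offers_made I A \<longleftrightarrow>
     c \<in> A \<and> (\<forall>d\<in>A. better I d c \<longrightarrow> d \<in> refused I (offers_made I A))"
  using offers_made_fixpoint[of I A] by (auto simp: offer_step_def)

lemma better_same_resident: "better I c d \<Longrightarrow> fst c = fst d"
  by (auto simp: better_def)

lemma better_irrefl: "\<not> better I c c"
  by (auto simp: better_def)

section \<open>Preference orders of a valid instance\<close>

locale hrt =
  fixes I :: hrt_instance
  assumes valid: "hrt_mslq I"
begin

lemma res_pref_refl: "q \<in> residents I \<Longrightarrow> h \<in> hospitals I \<Longrightarrow> (h, h) \<in> res_pref I q"
  using valid by (auto simp: hrt_mslq_def preference_list_def preorder_on_def refl_on_def)

lemma res_pref_trans:
  "q \<in> residents I \<Longrightarrow> (a, b) \<in> res_pref I q \<Longrightarrow> (b, c) \<in> res_pref I q \<Longrightarrow> (a, c) \<in> res_pref I q"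
  using valid by (auto simp: hrt_mslq_def preference_list_def preorder_on_def dest: transD)

lemma res_pref_total:
  "q \<in> residents I \<Longrightarrow> a \<in> hospitals I \<Longrightarrow> b \<in> hospitals I \<Longrightarrow>
     (a, b) \<in> res_pref I q \<or> (b, a) \<in> res_pref I q"
  using valid res_pref_refl
  by (cases "a = b") (auto simp: hrt_mslq_def preference_list_def total_on_def)

lemma hosp_pref_refl: "h \<in> hospitals I \<Longrightarrow> q \<in> residents I \<Longrightarrow> (q, q) \<in> hosp_pref I h"
  using valid by (auto simp: hrt_mslq_def preference_list_def preorder_on_def refl_on_def)

lemma hosp_pref_trans:
  "h \<in> hospitals I \<Longrightarrow> (a, b) \<in> hosp_pref I h \<Longrightarrow> (b, c) \<in> hosp_pref I h \<Longrightarrow> (a, c) \<in> hosp_pref I h"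
  using valid by (auto simp: hrt_mslq_def preference_list_def preorder_on_def dest: transD)

lemma hosp_pref_total:
  "h \<in> hospitals I \<Longrightarrow> a \<in> residents I \<Longrightarrow> b \<in> residents I \<Longrightarrow>
     (a, b) \<in> hosp_pref I h \<or> (b, a) \<in> hosp_pref I h"
  using valid hosp_pref_refl
  by (cases "a = b") (auto simp: hrt_mslq_def preference_list_def total_on_def)

lemma lower_le_upper: "h \<in> hospitals I \<Longrightarrow> lower I h \<le> upper I h"
  using valid by (auto simp: hrt_mslq_def)

lemma hosp_before_linear:
  assumes h: "h \<in> hospitals I" and A: "A \<subseteq> residents I"
  shows "strict_linear_on A (hosp_before I h)"
proof -
  have "hosp_before I h a c" if "hosp_before I h a b" "hosp_before I h b c" for a b c
    using that hosp_pref_trans[OF h, of a b c] hosp_pref_trans[OF h, of b c a]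
      hosp_pref_trans[OF h, of c a b]
    unfolding hosp_before_def by auto
  then have "transp_on A (hosp_before I h)" by (blast intro: transp_onI)
  moreover have "irreflp_on A (hosp_before I h)"
    by (auto simp: irreflp_on_def hosp_before_def)
  moreover have "totalp_on A (hosp_before I h)"
    using hosp_pref_total[OF h] A unfolding totalp_on_def hosp_before_def
    by (metis linorder_neqE_nat subsetD)
  ultimately show ?thesis by (simp add: strict_linear_on_def)
qed

lemma better_trans:
  assumes "better I c d" "better I d e" "fst c \<in> residents I"
  shows "better I c e"
proof -
  obtain q h k q' h' k' q'' h'' k''
    where eq: "c = (q, h, k)" "d = (q', h', k')" "e = (q'', h'', k'')"
    by (metis prod_cases3)
  with assms have q: "q' = q" "q'' = q" "q \<in> residents I" by (auto simp: better_def)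
  note trans = res_pref_trans[OF q(3)]
  have "(h, h') \<in> res_pref I q" "(h', h'') \<in> res_pref I q"
    using assms(1,2) by (simp_all add: eq q better_def)
  \<comment> \<open>Indifference between the ends of the chain forces indifference along it, and
    then round, quota and index decide.\<close>
  then have "(h, h'') \<in> res_pref I q"
    and "(h'', h) \<in> res_pref I q \<Longrightarrow> (h', h) \<in> res_pref I q \<and> (h'', h') \<in> res_pref I q"
    using trans by blast+
  then show ?thesis
    using assms(1,2) unfolding eq q better_def prod.case
    by (elim conjE) (intro conjI; force)
qed

lemma better_total:
  assumes "c \<in> contracts I" "d \<in> contracts I" "fst c = fst d" "c \<noteq> d"
  shows "better I c d \<or> better I d c"
proof -
  obtain q h k h' k' where c: "c = (q, h, k)" "d = (q, h', k')"
    using assms(3) by (cases c, cases d) auto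
  then show ?thesis
    using assms res_pref_total[of q h h'] by (auto simp: better_def contracts_def)
qed

lemma ex_best:
  assumes "S \<subseteq> contracts I" "S \<noteq> {}"
  shows "\<exists>c\<in>S. \<forall>d\<in>S. \<not> better I d c"
proof -
  have "fst c \<in> residents I" if "c \<in> S" for c using that assms by (auto simp: contracts_def)
  then have "transp_on S (better I)" using better_trans by (blast intro: transp_onI)
  moreover have "asymp_on S (better I)"
    using better_trans better_irrefl \<open>\<And>c. c \<in> S \<Longrightarrow> fst c \<in> residents I\<close>
    by (blast intro: asymp_onI)
  ultimately show ?thesis
    using Finite_Set.bex_min_element[of S "better I"] assms better_irrefl
      finite_subset[OF assms(1) finite_contracts] by metis
qed

section \<open>Law of aggregate demand\<close>

lemma card_held:
  assumes Y: "Y \<subseteq> contracts I"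
  shows "card (held I Y) =
    (\<Sum>h\<in>hospitals I. min (card (offerers I Y h True)) (upper I h) +
       min (card (offerers I Y h False)) (lower I h - card (offerers I Y h True)))"
proof -
  let ?C = "\<lambda>h. (\<lambda>a. (a, h, True)) ` chosen I Y h True \<union> (\<lambda>a. (a, h, False)) ` chosen I Y h False"
  have fin: "finite (chosen I Y h k)" for h k
    by (auto simp: chosen_def initial_def)
  have sub: "(a, h, k) \<in> Y" if "a \<in> chosen I Y h k" for a h k
    using that by (auto simp: chosen_def initial_def offerers_def split: if_splits)
  have "held I Y = (\<Union>h\<in>hospitals I. ?C h)"
  proof
    show "held I Y \<subseteq> (\<Union>h\<in>hospitals I. ?C h)"
    proof
      fix c assume c: "c \<in> held I Y"
      obtain a h k where "c = (a, h, k)" by (cases c)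
      then show "c \<in> (\<Union>h\<in>hospitals I. ?C h)"
        using c Y by (cases k) (auto simp: held_def contracts_def)
    qed
    show "(\<Union>h\<in>hospitals I. ?C h) \<subseteq> held I Y"
      using sub by (auto simp: held_def)
  qed
  then have "card (held I Y) = (\<Sum>h\<in>hospitals I. card (?C h))"
    using fin by (simp only:) (rule card_UN_disjoint; auto)
  also have "\<dots> = (\<Sum>h\<in>hospitals I. min (card (offerers I Y h True)) (upper I h) +
       min (card (offerers I Y h False)) (lower I h - card (offerers I Y h True)))"
  proof (rule sum.cong[OF refl])
    fix h assume h: "h \<in> hospitals I"
    have "card (?C h) = card (chosen I Y h True) + card (chosen I Y h False)"
      using fin by (subst card_Un_disjoint) (auto simp: card_image inj_on_def)
    also have "card (chosen I Y h True) = min (card (offerers I Y h True)) (upper I h)"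
      unfolding chosen_def if_True
      by (rule card_initial[OF finite_offerers hosp_before_linear[OF h]]) (auto simp: offerers_def)
    also have "card (chosen I Y h False) =
        min (card (offerers I Y h False)) (lower I h - card (offerers I Y h True))"
      unfolding chosen_def by (simp add: card_initial[OF finite_offerers strict_linear_on_less])
    finally show "card (?C h) = min (card (offerers I Y h True)) (upper I h) +
       min (card (offerers I Y h False)) (lower I h - card (offerers I Y h True))" .
  qed
  finally show ?thesis .
qed

text \<open>An additional second proposal costs at most one first proposal, and only while there are
  fewer than \<open>l\<close> second proposals; since \<open>l \<le> u\<close>, the number of held
  second proposals then grows by one.\<close>

lemma card_held_mono:
  assumes "Y \<subseteq> Z" "Z \<subseteq> contracts I"
  shows "card (held I Y) \<le> card (held I Z)"
proof -
  have le: "min s u + min f (l - s) \<le> min s' u + min f' (l - s')"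
    if "s \<le> s'" "f \<le> f'" "l \<le> u" for s s' f f' l u :: nat
    using that by linarith
  have "card (offerers I Y h k) \<le> card (offerers I Z h k)" for h k
    using offerers_mono[OF assms(1)] by (simp add: card_mono)
  then show ?thesis
    using assms lower_le_upper by (auto simp: card_held intro!: sum_mono le)
qed

text \<open>Of two contracts offered by one resident, the better must have been refused before the
  other was offered. A post-fixed point suffices, so this also applies in the middle of a
  run.\<close>

lemma held_inj:
  assumes A: "A \<subseteq> contracts I" and Y: "Y \<subseteq> offer_step I A Y"
  shows "inj_on fst (held I Y)"
proof (rule inj_onI, rule ccontr)
  fix c d assume c: "c \<in> held I Y" "d \<in> held I Y" "fst c = fst d" "c \<noteq> d"
  then have Yc: "c \<in> Y" "d \<in> Y" by (auto simp: held_def)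
  then have "c \<in> A" "d \<in> A" using Y by (auto simp: offer_step_def)
  moreover then have "better I c d \<or> better I d c" using c A better_total by blast
  ultimately have "c \<in> refused I Y \<or> d \<in> refused I Y"
    using Y Yc by (auto simp: offer_step_def)
  then show False using c by (auto simp: refused_def)
qed

text \<open>The best unrefused contract of a resident is due to be offered, since everything better
  is refused; being offered and not refused, it is held.\<close>

lemma ex_held:
  assumes A: "A \<subseteq> contracts I" and Y: "offer_step I A Y \<subseteq> Y"
    and c: "c \<in> A" "c \<notin> refused I Y"
  shows "\<exists>d\<in>held I Y. fst d = fst c"
proof -
  let ?S = "{d \<in> A. fst d = fst c \<and> d \<notin> refused I Y}"
  obtain d where d: "d \<in> ?S" "\<forall>e\<in>?S. \<not> better I e d"
    using ex_best[of ?S] A c by blast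
  have "e \<in> refused I Y" if "e \<in> A" "better I e d" for e
  proof (rule ccontr)
    assume "e \<notin> refused I Y"
    then have "e \<in> ?S" using that(1) d(1) better_same_resident[OF that(2)] by simp
    then show False using d(2) that(2) by blast
  qed
  then have "d \<in> offer_step I A Y"
    using d by (auto simp: offer_step_def)
  then show ?thesis using d Y by (auto simp: refused_def)
qed

lemma offers_made_subset: "offers_made I A \<subseteq> A"
  using offers_made_iff by blast

lemma offers_made_held_inj:
  "A \<subseteq> contracts I \<Longrightarrow> inj_on fst (held I (offers_made I A))"
  by (rule held_inj[of A]) (simp_all add: offers_made_fixpoint)

lemma offers_made_ex_held:
  "A \<subseteq> contracts I \<Longrightarrow> c \<in> A \<Longrightarrow> c \<notin> refused I (offers_made I A) \<Longrightarrow>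
     \<exists>d\<in>held I (offers_made I A). fst d = fst c"
  by (rule ex_held[of A]) (simp_all add: offers_made_fixpoint)

section \<open>Strategy-proofness for cumulative offers\<close>

text \<open>
  Narrowing \<open>r\<close>'s list from the contracts at least as good as \<open>y\<close> to \<open>y\<close> alone loses no other
  resident and, by the law of aggregate demand (\<open>card_held_mono\<close>), cannot win \<open>r\<close> a place.
\<close>

lemma truncated_list_refused:
  assumes y: "y \<in> contracts I"
  defines "A1 \<equiv> {c \<in> contracts I. fst c = fst y \<longrightarrow> c = y}"
    and "A2 \<equiv> {c \<in> contracts I. fst c = fst y \<longrightarrow> \<not> better I y c}"
  assumes all: "\<And>d. d \<in> A2 \<Longrightarrow> fst d = fst y \<Longrightarrow> d \<in> refused I (offers_made I A2)"
  shows "y \<in> refused I (offers_made I A1)"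
proof (rule ccontr)
  let ?Y1 = "offers_made I A1" and ?Y2 = "offers_made I A2"
  assume "y \<notin> refused I ?Y1"
  have A: "A1 \<subseteq> contracts I" "A2 \<subseteq> contracts I" by (auto simp: A1_def A2_def)
  have "y \<in> A1" "y \<in> A2" using y by (auto simp: A1_def A2_def better_irrefl)
  \<comment> \<open>Refusal presupposes an offer. For this resident \<open>y\<close> is all that
    \<open>A1\<close> allows; for the others \<open>A1\<close> and \<open>A2\<close> agree.\<close>
  have "y \<in> ?Y2" using all \<open>y \<in> A2\<close> refused_subset by blast
  have sub: "?Y1 \<subseteq> ?Y2"
  proof (rule offers_made_least, rule subsetI)
    fix c assume c: "c \<in> offer_step I A1 ?Y2"
    show "c \<in> ?Y2"
    proof (cases "fst c = fst y")
      case True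
      then show ?thesis using c \<open>y \<in> ?Y2\<close> by (auto simp: offer_step_def A1_def)
    next
      case False
      have "d \<in> refused I ?Y2" if "d \<in> A2" "better I d c" for d
      proof -
        have "d \<in> A1"
          using that(1) False better_same_resident[OF that(2)] by (simp add: A1_def A2_def)
        then show ?thesis using c that(2) by (simp add: offer_step_def)
      qed
      moreover have "c \<in> A2" using c False by (auto simp: offer_step_def A1_def A2_def)
      ultimately show ?thesis using offers_made_iff by blast
    qed
  qed
  let ?m1 = "fst ` held I ?Y1" and ?m2 = "fst ` held I ?Y2"
  have "?m2 \<subset> ?m1"
  proof
    show "?m2 \<subseteq> ?m1"
    proof
      fix q assume "q \<in> ?m2"
      then obtain c where c: "c \<in> held I ?Y2" "fst c = q" by blast
      then have "c \<in> ?Y2" "c \<notin> refused I ?Y2" by (auto simp: held_def refused_def)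
      moreover from this have "c \<in> A2" using offers_made_subset by blast
      ultimately have "fst c \<noteq> fst y" "c \<in> A1" using all[of c] by (auto simp: A1_def A2_def)
      \<comment> \<open>By substitutability a contract that survives the larger set of offers is not
        refused from the smaller one, so its resident keeps a place.\<close>
      moreover have "c \<notin> refused I ?Y1"
        using \<open>c \<notin> refused I ?Y2\<close> refused_mono[OF sub] by blast
      ultimately show "q \<in> ?m1" using offers_made_ex_held[OF A(1)] c(2) by (metis image_eqI)
    qed
    have "fst y \<in> ?m1"
      using offers_made_ex_held[OF A(1) \<open>y \<in> A1\<close> \<open>y \<notin> refused I ?Y1\<close>] by (metis image_eqI)
    moreover have "fst y \<notin> ?m2"
    proof
      assume "fst y \<in> ?m2"
      then obtain c where c: "c \<in> held I ?Y2" "fst c = fst y" by auto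
      then have "c \<in> A2" using offers_made_subset by (auto simp: held_def)
      then show False using all[of c] c by (auto simp: refused_def)
    qed
    ultimately show "?m2 \<noteq> ?m1" by blast
  qed
  moreover have fin: "finite (held I ?Y1)"
    by (rule finite_subset[OF _ finite_contracts[of I]])
      (use offers_made_subset[of A1] A in \<open>auto simp: held_def\<close>)
  ultimately have "card ?m2 < card ?m1" by (intro psubset_card_mono) auto
  \<comment> \<open>Each matched resident holds one contract, so counting residents is counting
    contracts.\<close>
  then have "card (held I ?Y2) < card (held I ?Y1)"
    using offers_made_held_inj A by (simp add: card_image)
  moreover have "card (held I ?Y1) \<le> card (held I ?Y2)"
    using card_held_mono[OF sub] offers_made_subset[of A2] A by blast
  ultimately show False by simp
qed

text \<open>A lie does not even gain a better contract, which is finer than a better hospital. A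
  gain \<open>y\<close> would be refused from the list \<open>A1\<close>, whose offers are among
  those of the lie, where \<open>y\<close> is held.\<close>

lemma strategyproof_offers:
  assumes I': "I' = I\<lparr>res_pref := (res_pref I)(r := P')\<rparr>"
    and x: "x \<in> held I (offers_made I (contracts I))" "fst x = r"
    and y: "y \<in> held I' (offers_made I' (contracts I'))" "fst y = r"
  shows "\<not> better I y x"
proof
  assume yx: "better I y x"
  define A1 where "A1 = {c \<in> contracts I. fst c = fst y \<longrightarrow> c = y}"
  define A2 where "A2 = {c \<in> contracts I. fst c = fst y \<longrightarrow> \<not> better I y c}"
  let ?Y = "offers_made I (contracts I)" and ?Y' = "offers_made I' (contracts I')"
  let ?Y1 = "offers_made I A1" and ?Y2 = "offers_made I A2"
  have contracts': "contracts I' = contracts I"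
    by (simp add: I' contracts_def residents_def hospitals_def)
  \<comment> \<open>The choices of hospitals ignore the lists of residents, so both instances share
    \<open>held\<close> and \<open>refused\<close>; only \<open>better\<close> on contracts of
    \<open>r\<close> differs.\<close>
  have "hosp_before I' = hosp_before I" by (simp add: I' hosp_before_def fun_eq_iff)
  then have held': "held I' Y = held I Y" for Y
    by (simp add: I' held_def chosen_def offerers_def residents_def)
  have refused': "refused I' Y = refused I Y" for Y using held' by (simp add: refused_def)
  have better': "better I' c d \<longleftrightarrow> better I c d" if "fst c \<noteq> r" for c d
    using that by (cases c) (auto simp: I' better_def)
  have y': "y \<in> ?Y'" "y \<in> contracts I" "y \<notin> refused I ?Y'"
  proof -
    have "y \<in> held I ?Y'" using y(1) by (simp add: held')
    then show "y \<in> ?Y'" "y \<notin> refused I ?Y'" by (auto simp: refused_def held_def)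
    then show "y \<in> contracts I" using offers_made_iff[of y I' "contracts I'"] contracts' by blast
  qed
  have "d \<in> refused I ?Y2" if d: "d \<in> A2" "fst d = fst y" for d
  proof (rule ccontr)
    assume nd: "d \<notin> refused I ?Y2"
    have dc: "d \<in> contracts I" "\<not> better I y d" using d by (auto simp: A2_def)
    \<comment> \<open>\<open>d\<close> is \<open>y\<close> or better than it. While \<open>d\<close>
      is unrefused nothing below \<open>y\<close> is offered, so the truthful offers stay within the
      truncated ones; yet \<open>x\<close> lies below \<open>d\<close> and was offered.\<close>
    have better_d: "better I d c" if "better I y c" "c \<in> contracts I" for c
    proof (cases "d = y")
      case False
      then have "better I d y" using better_total[of d y] dc d(2) y' by blast
      moreover have "fst d \<in> residents I" using dc(1) by (auto simp: contracts_def)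
      ultimately show ?thesis using better_trans that(1) by blast
    qed (use that in simp)
    have sub: "?Y \<subseteq> ?Y2"
    proof (rule offers_made_least, rule subsetI)
      fix c assume c: "c \<in> offer_step I (contracts I) ?Y2"
      have "\<not> better I y c"
        using better_d[of c] c nd dc by (auto simp: offer_step_def)
      then have "c \<in> offer_step I A2 ?Y2" using c by (auto simp: offer_step_def A2_def)
      then show "c \<in> ?Y2" by (simp add: offers_made_fixpoint)
    qed
    have "x \<in> ?Y" "x \<in> contracts I"
      using x(1) offers_made_iff[of x I "contracts I"] by (auto simp: held_def)
    then have "d \<in> refused I ?Y"
      using better_d[OF yx] dc(1) offers_made_iff[of x I "contracts I"] by blast
    then show False using nd refused_mono[OF sub] by blast
  qed
  then have "y \<in> refused I ?Y1"
    using truncated_list_refused[OF y'(2)] unfolding A1_def A2_def by blast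
  moreover have "?Y1 \<subseteq> ?Y'"
  proof (rule offers_made_least, rule subsetI)
    fix c assume c: "c \<in> offer_step I A1 ?Y'"
    show "c \<in> ?Y'"
    proof (cases "fst c = fst y")
      case True
      then show ?thesis using c y'(1) by (auto simp: offer_step_def A1_def)
    next
      case False
      have "d \<in> refused I' ?Y'" if d: "d \<in> contracts I'" "better I' d c" for d
      proof -
        have "fst d = fst c" using d(2) by (rule better_same_resident)
        then have "better I d c" "d \<in> A1"
          using d False y(2) better'[of d c] by (auto simp: A1_def contracts')
        then show ?thesis using c by (auto simp: offer_step_def refused')
      qed
      moreover have "c \<in> contracts I'" using c by (auto simp: offer_step_def A1_def contracts')
      ultimately show ?thesis using offers_made_iff by blast
    qed
  qed
  ultimately show False using y'(3) refused_mono by blast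
qed

section \<open>Runs of Double Proposal\<close>

text \<open>Choosing the largest index within the worst indifference class gives the last element of
  the strict order \<open>hosp_before\<close>.\<close>

lemma worst_last:
  assumes h: "h \<in> hospitals I" and A: "A \<subseteq> residents I" "A \<noteq> {}"
  shows "worst I h A \<in> A"
    and "x \<in> A \<Longrightarrow> x \<noteq> worst I h A \<Longrightarrow> hosp_before I h x (worst I h A)"
proof -
  let ?W = "{r \<in> A. \<forall>r'\<in>A. (r', r) \<in> hosp_pref I h}"
  have finA: "finite A" using A(1) finite_residents by (rule finite_subset)
  have lin: "strict_linear_on A (hosp_before I h)" using hosp_before_linear[OF h A(1)] .
  have "\<exists>m\<in>A. \<forall>x\<in>A. x \<noteq> m \<longrightarrow> \<not> hosp_before I h m x"
  proof (rule Finite_Set.bex_max_element[OF finA _ _ A(2)])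
    show "asymp_on A (hosp_before I h)"
      using strict_linear_asym[OF finA lin] by (rule asymp_onI)
    show "transp_on A (hosp_before I h)" using lin by (simp add: strict_linear_on_def)
  qed
  then obtain m where m: "m \<in> A" "\<And>x. x \<in> A \<Longrightarrow> x \<noteq> m \<Longrightarrow> hosp_before I h x m"
    using strict_linear_total[OF finA lin] by metis
  then have "(x, m) \<in> hosp_pref I h" if "x \<in> A" for x
    using that hosp_pref_refl[OF h] A(1) by (cases "x = m") (auto simp: hosp_before_def)
  with m(1) have "?W \<noteq> {}" by blast
  moreover have finW: "finite ?W" using finA by simp
  ultimately have w: "worst I h A \<in> ?W" unfolding worst_def by (rule Max_in[rotated])
  then show "worst I h A \<in> A" by blast
  show "hosp_before I h x (worst I h A)" if x: "x \<in> A" "x \<noteq> worst I h A"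
  proof (cases "(worst I h A, x) \<in> hosp_pref I h")
    case True
    then have "x \<in> ?W" using w x hosp_pref_trans[OF h] by blast
    then have "x \<le> worst I h A" unfolding worst_def by (rule Max_ge[OF finW])
    then show ?thesis using w x by (simp add: hosp_before_def)
  next
    case False
    then show ?thesis using w x by (simp add: hosp_before_def)
  qed
qed

lemma top_tie_nonempty:
  assumes q: "q \<in> residents I" and ne: "current_list I s q \<noteq> {}"
  shows "top_tie I s q \<noteq> {}"
proof -
  let ?S = "(\<lambda>h. (q, h, False)) ` current_list I s q"
  have "?S \<subseteq> contracts I" using q by (auto simp: contracts_def current_list_def)
  then obtain h where h: "h \<in> current_list I s q"
      "\<And>h'. h' \<in> current_list I s q \<Longrightarrow> \<not> better I (q, h', False) (q, h, False)"
    using ex_best[of ?S] ne by auto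
  then have "(h, h') \<in> res_pref I q" if "h' \<in> current_list I s q" for h'
    using that res_pref_total[OF q, of h h'] by (auto simp: better_def current_list_def)
  then show ?thesis using h(1) by (auto simp: top_tie_def)
qed

lemma min_lower_least:
  assumes C: "finite C" "C \<noteq> {}"
  shows "min_lower I C \<in> C"
    and "h' \<in> C \<Longrightarrow> lower I (min_lower I C) < lower I h' \<or>
           lower I (min_lower I C) = lower I h' \<and> min_lower I C \<le> h'"
proof -
  let ?L = "{h \<in> C. \<forall>h'\<in>C. lower I h \<le> lower I h'}"
  obtain m where "m \<in> C" "\<And>h'. h' \<in> C \<Longrightarrow> lower I m \<le> lower I h'"
    using arg_min_if_finite(1)[OF C] arg_min_least[OF C] by metis
  then have "?L \<noteq> {}" by blast
  moreover have finL: "finite ?L" using C by simp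
  ultimately have m: "min_lower I C \<in> ?L" unfolding min_lower_def by (rule Min_in[rotated])
  then show "min_lower I C \<in> C" by blast
  assume h': "h' \<in> C"
  show "lower I (min_lower I C) < lower I h' \<or>
           lower I (min_lower I C) = lower I h' \<and> min_lower I C \<le> h'"
  proof (cases "h' \<in> ?L")
    case True
    then have "min_lower I C \<le> h'" unfolding min_lower_def by (rule Min_le[OF finL])
    then show ?thesis using m h' by (auto simp: order_le_less)
  next
    case False
    then show ?thesis using m h' by (force simp: not_le)
  qed
qed

section \<open>Translation of states into contracts\<close>

text \<open>States do not record second proposals as such; they are recovered from residents who
  were rejected and are assigned again, or who are deleted.\<close>

definition offers :: "state \<Rightarrow> contract set" where
  "offers s = {(q, h, k). if k then (q, h) \<in> rejected s \<inter> asg s \<union> deleted s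
                          else (q, h) \<in> proposed s}"

text \<open>Each hospital holds its cumulative choice, every offer was due, and no offer exceeds the
  least fixed point. Equality with the fixed point is reached only when the loop stops.\<close>

definition state_inv :: "state \<Rightarrow> bool" where
  "state_inv s \<longleftrightarrow>
     (\<forall>h. hosp_inv (hosp_before I h) (lower I h) (upper I h)
        (residents_of (proposed s) h) (residents_of (rejected s) h)
        (residents_of (asg s) h) (residents_of (deleted s) h)) \<and>
     offers s \<subseteq> offer_step I (contracts I) (offers s) \<and>
     offers s \<subseteq> offers_made I (contracts I)"

lemma state_inv_init: "state_inv init_state"
  by (auto simp: state_inv_def init_state_def offers_def residents_of_def hosp_inv_def
      initial_def split: if_splits)

context
  fixes s :: state
  assumes inv: "state_inv s"
begin

lemma offers_subset: "offers s \<subseteq> contracts I"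
  using inv by (auto simp: state_inv_def offer_step_def)

lemma proposed_subset: "(q, h) \<in> proposed s \<Longrightarrow> q \<in> residents I \<and> h \<in> hospitals I"
  using subsetD[OF offers_subset, of "(q, h, False)"] by (simp add: offers_def contracts_def)

lemma residents_of_subset:
  "residents_of (proposed s) h \<subseteq> residents I"
  "residents_of (asg s) h \<union> residents_of (rejected s) h = residents_of (proposed s) h"
  "residents_of (deleted s) h \<subseteq> residents_of (rejected s) h"
  "residents_of (deleted s) h \<inter> residents_of (asg s) h = {}"
proof -
  show "residents_of (proposed s) h \<subseteq> residents I"
    using proposed_subset by (auto simp: residents_of_def)
qed (use inv in \<open>simp_all add: state_inv_def hosp_inv_def\<close>)

lemma asg_rejected_proposed:
  "(q, h) \<in> proposed s \<longleftrightarrow> (q, h) \<in> asg s \<or> (q, h) \<in> rejected s"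
  "(q, h) \<in> deleted s \<Longrightarrow> (q, h) \<in> rejected s"
  "(q, h) \<in> deleted s \<Longrightarrow> (q, h) \<notin> asg s"
  using residents_of_subset(2-)[of h] by (auto simp: residents_of_def)

lemma offerers_offers:
  "offerers I (offers s) h False = residents_of (proposed s) h"
  "offerers I (offers s) h True =
     residents_of (rejected s) h \<inter> residents_of (asg s) h \<union> residents_of (deleted s) h"
  using residents_of_subset[of h]
  by (auto simp: offerers_def offers_def residents_of_def)

text \<open>\<open>hosp_inv\<close> is the definition of \<open>chosen\<close> applied to the offers
  of the state; a past rejection tells which of the two proposals is held.\<close>

lemma held_offers:
  "(q, h, k) \<in> held I (offers s) \<longleftrightarrow> (q, h) \<in> asg s \<and> (k \<longleftrightarrow> (q, h) \<in> rejected s)"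
proof -
  have "chosen I (offers s) h k =
     (if k then residents_of (rejected s) h \<inter> residents_of (asg s) h
      else residents_of (asg s) h - residents_of (rejected s) h)"
    using inv by (simp add: chosen_def offerers_offers state_inv_def hosp_inv_def)
  then show ?thesis
    using asg_rejected_proposed[of q h] by (auto simp: held_def offers_def residents_of_def)
qed

lemma refused_offers:
  "(q, h, k) \<in> refused I (offers s) \<longleftrightarrow> (if k then (q, h) \<in> deleted s else (q, h) \<in> rejected s)"
  unfolding refused_def Diff_iff held_offers
  using asg_rejected_proposed[of q h] by (auto simp: offers_def)

lemma held_offers_inj: "inj_on fst (held I (offers s))"
  using inv by (intro held_inj[OF order_refl]) (simp add: state_inv_def)

text \<open>A resident deleted everywhere would leave every hospital with \<open>upper I h\<close>
  held contracts. Since each resident holds at most one, there would be at least as many residents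
  as places.\<close>

lemma current_list_nonempty:
  assumes q: "q \<in> residents I"
  shows "current_list I s q \<noteq> {}"
proof
  assume e: "current_list I s q = {}"
  have full: "upper I h \<le> min (card (offerers I (offers s) h True)) (upper I h) +
       min (card (offerers I (offers s) h False))
         (lower I h - card (offerers I (offers s) h True))"
    if h: "h \<in> hospitals I" for h
  proof -
    let ?S = "offerers I (offers s) h True"
    have "(q, h) \<in> deleted s" using e h by (auto simp: current_list_def)
    then have "q \<in> ?S" "q \<notin> initial (hosp_before I h) (upper I h) ?S"
      using inv asg_rejected_proposed[of q h]
      by (auto simp: offerers_offers state_inv_def hosp_inv_def residents_of_def)
    then have "initial (hosp_before I h) (upper I h) ?S \<noteq> ?S" by blast
    moreover have "strict_linear_on ?S (hosp_before I h)"
      by (rule hosp_before_linear[OF h]) (auto simp: offerers_def)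
    ultimately have "\<not> card ?S \<le> upper I h" using initial_all[OF finite_offerers] by blast
    then show ?thesis by simp
  qed
  have "fst ` held I (offers s) \<subseteq> residents I"
    using offers_subset by (auto simp: held_def contracts_def)
  then have "card (fst ` held I (offers s)) \<le> card (residents I)"
    by (rule card_mono[OF finite_residents])
  then have "card (held I (offers s)) \<le> card (residents I)"
    by (simp add: card_image[OF held_offers_inj])
  also have "\<dots> < (\<Sum>h\<in>hospitals I. upper I h)" using valid by (simp add: hrt_mslq_def)
  also have "\<dots> \<le> card (held I (offers s))"
    unfolding card_held[OF offers_subset] by (rule sum_mono) (rule full)
  finally show False by simp
qed

text \<open>The algorithm proposes precisely a contract that is due and new, so its steps are steps
  of the fixed point iteration.\<close>

lemma proposal_target_best:
  assumes q: "q \<in> residents I" and unm: "hospitals_of (asg s) q = {}"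
  defines "h \<equiv> proposal_target I s q"
  defines "c \<equiv> (q, h, (q, h) \<in> proposed s)"
  shows "h \<in> hospitals I" "(q, h) \<notin> deleted s" "c \<notin> offers s"
    and "c \<in> offer_step I (contracts I) (offers s)"
proof -
  let ?T = "top_tie I s q"
  let ?N = "{h \<in> ?T. (q, h) \<notin> proposed s}"
  have T_ne: "?T \<noteq> {}" using top_tie_nonempty[OF q current_list_nonempty[OF q]] .
  have T_fin: "finite ?T"
    by (rule finite_subset[OF _ finite_hospitals[of I]])
      (auto simp: top_tie_def current_list_def)
  define C where "C = (if ?N \<noteq> {} then ?N else ?T)"
  have C: "finite C" "C \<noteq> {}" "C \<subseteq> ?T" using T_fin T_ne by (auto simp: C_def)
  have "h = min_lower I C" 
    unfolding h_def proposal_target_def C_def Let_def by (rule if_distrib[symmetric])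
  then have hC: "h \<in> C"
    and least: "\<And>h'. h' \<in> C \<Longrightarrow> lower I h < lower I h' \<or> lower I h = lower I h' \<and> h \<le> h'"
    using min_lower_least[OF C(1,2)] by auto
  have hT: "h \<in> ?T" using hC C(3) by blast
  then show h: "h \<in> hospitals I" "(q, h) \<notin> deleted s" by (auto simp: top_tie_def current_list_def)
  have unm': "(q, h') \<notin> asg s" for h' using unm by (auto simp: hospitals_of_def)
  show "c \<notin> offers s" using unm' h(2) by (auto simp: c_def offers_def)
  have "d \<in> refused I (offers s)" if d: "d \<in> contracts I" "better I d c" for d
  proof -
    obtain h' k' where deq: "d = (q, h', k')" and h': "h' \<in> hospitals I"
      and b: "(h, h') \<notin> res_pref I q \<or> k' < ((q, h) \<in> proposed s) \<or>
          k' = ((q, h) \<in> proposed s) \<and>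
            (lower I h' < lower I h \<or> lower I h' = lower I h \<and> h' < h)"
      and b': "(h', h) \<in> res_pref I q"
      using d by (cases d) (auto simp: better_def c_def contracts_def)
    show ?thesis
    proof (cases "h' \<in> current_list I s q")
      case False
      then show ?thesis
        using h' asg_rejected_proposed(2) by (auto simp: deq refused_offers current_list_def)
    next
      case True
      then have hh': "(h, h') \<in> res_pref I q" using hT by (auto simp: top_tie_def)
      have "h' \<in> ?T"
        using True hT b' res_pref_trans[OF q b'] by (auto simp: top_tie_def)
      have "\<not> (lower I h' < lower I h \<or> lower I h' = lower I h \<and> h' < h)" if "h' \<in> C"
        using least[OF that] by auto
      \<comment> \<open>If minimality of \<open>h\<close> in the pool \<open>C\<close> does not
        exclude \<open>d\<close>, then \<open>d\<close> is a first proposal already made; as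
        \<open>q\<close> is unassigned, it was rejected.\<close>
      moreover have "k' = False \<and> (q, h') \<in> proposed s"
        if "h' \<notin> C \<or> k' < ((q, h) \<in> proposed s)"
      proof (cases "?N = {}")
        case True
        then show ?thesis using that \<open>h' \<in> ?T\<close> by (auto simp: C_def)
      next
        case False
        then have "(q, h) \<notin> proposed s" using hC by (auto simp: C_def)
        then show ?thesis using that False \<open>h' \<in> ?T\<close> b hh' by (auto simp: C_def)
      qed
      ultimately have "k' = False \<and> (q, h') \<in> proposed s" using b hh' by blast
      then show ?thesis
        using unm' asg_rejected_proposed(1) by (simp add: deq refused_offers)
    qed
  qed
  then show "c \<in> offer_step I (contracts I) (offers s)"
    using q h by (auto simp: offer_step_def c_def contracts_def)
qed

end

section \<open>One step of the loop\<close>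

lemma residents_of_insert:
  "residents_of (insert (q, h) X) h' = (if h' = h then insert q (residents_of X h) else residents_of X h')"
  by (auto simp: residents_of_def)

lemma residents_of_remove:
  "residents_of (X - {(q, h)}) h' = (if h' = h then residents_of X h - {q} else residents_of X h')"
  by (auto simp: residents_of_def)

lemma mem_offers:
  "(a, h, k) \<in> offers s \<longleftrightarrow>
     a \<in> (if k then residents_of (rejected s) h \<inter> residents_of (asg s) h \<union> residents_of (deleted s) h
          else residents_of (proposed s) h)"
  by (auto simp: offers_def residents_of_def)

text \<open>Other hospitals are untouched, and the four reactions cover \<open>h\<close>. Exactly
  one new contract is added per step, which also yields termination.\<close>

lemma dp_step_inv:
  assumes inv_s: "state_inv s" and unm: "unmatched I s \<noteq> {}"
  shows "state_inv (dp_step I s) \<and> (\<exists>c. c \<notin> offers s \<and> offers (dp_step I s) = insert c (offers s))"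
proof -
  define q where "q = Min (unmatched I s)"
  define h where "h = proposal_target I s q"
  define c where "c = (q, h, (q, h) \<in> proposed s)"
  define s0 where "s0 = s\<lparr>proposed := proposed s \<union> {(q, h)}\<rparr>"
  define s' where "s' = respond I q h s0"
  have step: "dp_step I s = s'"
    by (simp add: dp_step_def Let_def s'_def s0_def h_def q_def)
  have "finite (unmatched I s)" by (simp add: unmatched_def)
  then have "q \<in> unmatched I s" unfolding q_def using unm by (rule Min_in)
  then have q: "q \<in> residents I" "hospitals_of (asg s) q = {}" by (auto simp: unmatched_def)
  note target = proposal_target_best[OF inv_s q, folded h_def, folded c_def]
  define F where "F = residents_of (proposed s) h"
  define R where "R = residents_of (rejected s) h"
  define M where "M = residents_of (asg s) h"
  define D where "D = residents_of (deleted s) h"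
  note slices = F_def R_def M_def D_def
  have F_res: "F \<subseteq> residents I" unfolding F_def by (rule residents_of_subset[OF inv_s])
  have M_res: "insert q M \<subseteq> residents I"
    using residents_of_subset(1,2)[OF inv_s, of h] q(1) by (auto simp: M_def)
  interpret hospital_state "hosp_before I h" "lower I h" "upper I h" F R M D q
  proof
    show "finite F" using F_res finite_residents by (rule finite_subset)
    show "strict_linear_on (insert q F) (hosp_before I h)"
      using F_res q(1) by (intro hosp_before_linear target(1)) simp
    show "hosp_inv (hosp_before I h) (lower I h) (upper I h) F R M D"
      using inv_s by (simp add: state_inv_def slices)
    show "q \<notin> M" using q(2) by (auto simp: M_def residents_of_def hospitals_of_def)
    show "q \<notin> D" using target(2) by (simp add: D_def residents_of_def)
  qed (rule lower_le_upper[OF target(1)])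
  have N: "{r' \<in> M \<union> {q}. (r', h) \<notin> rejected s} = insert q M - R"
    by (auto simp: R_def residents_of_def)
  define w1 where "w1 = Max (insert q M - R)"
  define w2 where "w2 = worst I h (insert q M)"
  have s'_eq: "s' =
    (if card M < lower I h then s0\<lparr>asg := asg s \<union> {(q, h)}\<rparr>
     else if insert q M - R \<noteq> {} then
       s0\<lparr>asg := asg s \<union> {(q, h)} - {(w1, h)}, rejected := rejected s \<union> {(w1, h)}\<rparr>
     else if card M < upper I h then s0\<lparr>asg := asg s \<union> {(q, h)}\<rparr>
     else s0\<lparr>asg := asg s \<union> {(q, h)} - {(w2, h)}, rejected := rejected s \<union> {(w2, h)},
             deleted := deleted s \<union> {(w2, h)}\<rparr>)"
  proof -
    have s0: "asg s0 = asg s" "rejected s0 = rejected s" "deleted s0 = deleted s"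
      by (simp_all add: s0_def)
    show ?thesis
      unfolding s'_def respond_def Let_def s0 M_def[symmetric] N w1_def[symmetric]
      by (simp add: w2_def)
  qed
  have proposed_new: "residents_of (proposed s') h = insert q F"
    "\<And>h'. h' \<noteq> h \<Longrightarrow> residents_of (proposed s') h' = residents_of (proposed s) h'"
    by (simp_all add: s'_eq s0_def residents_of_insert F_def)
  have other: "residents_of (asg s') h' = residents_of (asg s) h'"
    "residents_of (rejected s') h' = residents_of (rejected s) h'"
    "residents_of (deleted s') h' = residents_of (deleted s) h'" if "h' \<noteq> h" for h'
    using that by (simp_all add: s'_eq s0_def residents_of_insert residents_of_remove)
  let ?R = "residents_of (rejected s') h" and ?M = "residents_of (asg s') h"
    and ?D = "residents_of (deleted s') h"
  have at_h: "hosp_inv (hosp_before I h) (lower I h) (upper I h) (insert q F) ?R ?M ?D \<and>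
    ?R \<inter> ?M \<union> ?D = (if q \<in> F then insert q S else S)"
  proof -
    consider (1) "card M < lower I h"
      | (2) "lower I h \<le> card M" "insert q M - R \<noteq> {}"
      | (3) "lower I h \<le> card M" "insert q M - R = {}" "card M < upper I h"
      | (4) "lower I h \<le> card M" "insert q M - R = {}" "upper I h \<le> card M"
      by linarith
    then show ?thesis
    proof cases
      case 1
      then have "?R = R" "?M = insert q M" "?D = D"
        by (simp_all add: s'_eq s0_def residents_of_insert slices)
      then show ?thesis using accept_below_lower[OF 1] by simp
    next
      case 2
      then have s'2: "s' = s0\<lparr>asg := asg s \<union> {(q, h)} - {(w1, h)},
          rejected := rejected s \<union> {(w1, h)}\<rparr>"
        by (simp only: s'_eq not_less[symmetric] if_False if_True simp_thms)
      have "?R = insert w1 R" "?M = insert q M - {w1}" "?D = D"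
        by (simp_all add: s'2 s0_def residents_of_insert residents_of_remove slices)
      then show ?thesis using reject_first[OF 2] unfolding w1_def by simp
    next
      case 3
      then have "s' = s0\<lparr>asg := asg s \<union> {(q, h)}\<rparr>"
        by (simp only: s'_eq not_less[symmetric] if_False if_True simp_thms)
      then have "?R = R" "?M = insert q M" "?D = D"
        by (simp_all add: s0_def residents_of_insert slices)
      then show ?thesis using accept_second[OF 3] by simp
    next
      case 4
      then have s'4: "s' = s0\<lparr>asg := asg s \<union> {(q, h)} - {(w2, h)},
          rejected := rejected s \<union> {(w2, h)}, deleted := deleted s \<union> {(w2, h)}\<rparr>"
        by (simp only: s'_eq not_less[symmetric] if_False if_True simp_thms)
      have "?R = insert w2 R" "?M = insert q M - {w2}" "?D = insert w2 D"
        by (simp_all add: s'4 s0_def residents_of_insert residents_of_remove slices)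
      moreover have "w2 \<in> insert q M"
        "\<And>x. x \<in> insert q M \<Longrightarrow> x \<noteq> w2 \<Longrightarrow> hosp_before I h x w2"
        using worst_last[OF target(1) M_res] unfolding w2_def by simp_all
      ultimately show ?thesis using reject_second[OF 4] by simp
    qed
  qed
  have offers': "offers s' = insert c (offers s)"
  proof -
    have "(a, h', k) \<in> offers s' \<longleftrightarrow> (a, h', k) \<in> insert c (offers s)" for a h' k
    proof (cases "h' = h")
      case False
      then show ?thesis by (simp add: mem_offers proposed_new other c_def)
    next
      case True
      have "(q, h) \<in> proposed s \<longleftrightarrow> q \<in> F" by (simp add: F_def residents_of_def)
      moreover have "(a, h, True) \<in> offers s' \<longleftrightarrow> a \<in> ?R \<inter> ?M \<union> ?D"
        "(a, h, True) \<in> offers s \<longleftrightarrow> a \<in> S"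
        "(a, h, False) \<in> offers s' \<longleftrightarrow> a \<in> insert q F"
        "(a, h, False) \<in> offers s \<longleftrightarrow> a \<in> F"
        by (simp_all add: mem_offers proposed_new slices)
      ultimately show ?thesis
        using at_h True by (cases k; cases "q \<in> F") (auto simp: c_def)
    qed
    then show ?thesis by (auto simp: set_eq_iff)
  qed
  have "state_inv s'"
    unfolding state_inv_def
  proof (intro conjI allI)
    show "hosp_inv (hosp_before I h') (lower I h') (upper I h')
        (residents_of (proposed s') h') (residents_of (rejected s') h')
        (residents_of (asg s') h') (residents_of (deleted s') h')" for h'
      using at_h inv_s by (cases "h' = h") (simp_all add: proposed_new other state_inv_def)
    have sub: "offers s \<subseteq> offer_step I (contracts I) (offers s)"
      "offers s \<subseteq> offers_made I (contracts I)"
      using inv_s by (simp_all add: state_inv_def)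
    have "insert c (offers s) \<subseteq> offer_step I (contracts I) (offers s)"
      using target(4) sub(1) by simp
    also have "\<dots> \<subseteq> offer_step I (contracts I) (offers s')"
      unfolding offers' by (rule monoD[OF offer_step_mono]) blast
    finally show "offers s' \<subseteq> offer_step I (contracts I) (offers s')"
      unfolding offers' .
    have "c \<in> offers_made I (contracts I)"
      \<comment> \<open>What is due after offers inside the least fixed point is due there too,
        hence belongs to it.\<close>
      using target(4) monoD[OF offer_step_mono sub(2)] offers_made_fixpoint by blast
    then show "offers s' \<subseteq> offers_made I (contracts I)"
      using sub(2) by (simp add: offers')
  qed
  then show ?thesis using target(3) offers' unfolding step by blast
qed

text \<open>Everyone holds a contract \<open>d\<close>. A contract that is due cannot lie below the
  unrefused \<open>d\<close>, so it is \<open>d\<close> or better; in the latter case it was refused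
  before \<open>d\<close> was offered. Hence no offer is missing.\<close>

lemma offers_final:
  assumes inv: "state_inv s" and fin: "unmatched I s = {}"
  shows "offers s = offers_made I (contracts I)"
proof
  show "offers s \<subseteq> offers_made I (contracts I)" using inv by (simp add: state_inv_def)
  show "offers_made I (contracts I) \<subseteq> offers s"
  proof (rule offers_made_least, rule subsetI)
    fix c assume c: "c \<in> offer_step I (contracts I) (offers s)"
    then have cc: "c \<in> contracts I" by (simp add: offer_step_def)
    then have "fst c \<in> residents I" by (auto simp: contracts_def)
    then obtain h where "(fst c, h) \<in> asg s"
      using fin by (auto simp: unmatched_def hospitals_of_def)
    then obtain d where d: "d \<in> held I (offers s)" "fst d = fst c"
      using held_offers[OF inv, of "fst c" h "(fst c, h) \<in> rejected s"] by force
    then have d_Y: "d \<in> offers s" "d \<notin> refused I (offers s)" by (auto simp: held_def refused_def)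
    then have dc: "d \<in> contracts I" using offers_subset[OF inv] by blast
    show "c \<in> offers s"
    proof (cases "c = d")
      case False
      have "\<not> better I d c" using c d_Y(2) dc by (auto simp: offer_step_def)
      then have "better I c d" using better_total[OF cc dc] d(2) False by auto
      then have "c \<in> refused I (offers s)"
        using d_Y(1) cc inv by (auto simp: state_inv_def offer_step_def)
      then show ?thesis using refused_subset by blast
    qed (use d_Y in simp)
  qed
qed

lemma double_proposal_run:
  "\<exists>M. double_proposal I = Some M \<and>
    (\<forall>q\<in>residents I. \<exists>h k. hospitals_of M q = {h} \<and>
       (q, h, k) \<in> held I (offers_made I (contracts I)))"
proof -
  let ?b = "\<lambda>s. unmatched I s \<noteq> {}"
  \<comment> \<open>The number of contracts not yet offered drops with every step.\<close>
  let ?f = "\<lambda>s. card (contracts I) - card (offers s)"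
  have "?f (dp_step I s) < ?f s" if s: "state_inv s" "?b s" for s
  proof -
    have fin: "finite (offers s)" using offers_subset[OF s(1)] by (rule finite_subset) simp
    obtain c where c: "c \<notin> offers s" "offers (dp_step I s) = insert c (offers s)"
      using dp_step_inv[OF s] by blast
    moreover have "card (offers (dp_step I s)) \<le> card (contracts I)"
      using dp_step_inv[OF s] offers_subset by (intro card_mono) auto
    ultimately show ?thesis using fin by simp
  qed
  then obtain t where t: "while_option ?b (dp_step I) init_state = Some t"
    using measure_while_option_Some[of state_inv ?b "dp_step I" ?f] dp_step_inv state_inv_init
    by blast
  have inv: "state_inv t"
    by (rule while_option_rule[OF _ t, of state_inv]) (use dp_step_inv state_inv_init in auto)
  have fin: "unmatched I t = {}" using while_option_stop[OF t] by simp
  have "\<exists>h k. hospitals_of (asg t) q = {h} \<and> (q, h, k) \<in> held I (offers t)"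
    if "q \<in> residents I" for q
  proof -
    have "hospitals_of (asg t) q \<noteq> {}" using fin that by (auto simp: unmatched_def)
    then obtain h where h: "(q, h) \<in> asg t" by (auto simp: hospitals_of_def)
    have held: "(q, h', (q, h') \<in> rejected t) \<in> held I (offers t)" if "(q, h') \<in> asg t" for h'
      using that by (simp add: held_offers[OF inv])
    have "h' = h" if "(q, h') \<in> asg t" for h'
      using inj_onD[OF held_offers_inj[OF inv] _ held[OF that] held[OF h]] by simp
    then have "hospitals_of (asg t) q = {h}" using h unfolding hospitals_of_def by blast
    then show ?thesis using held[OF h] by blast
  qed
  then show ?thesis
    using t by (auto simp: double_proposal_def offers_final[OF inv fin])
qed

end

theorem theorem4:
  fixes I I' :: hrt_instance and r :: nat and P' :: "(nat \<times> nat) set"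
  assumes "hrt_mslq I"
    and "r \<in> residents I"
    and "preference_list (hospitals I) P'"
    and "I' = I\<lparr>res_pref := (res_pref I)(r := P')\<rparr>"
  shows "\<exists>M M' h h'. double_proposal I = Some M \<and> double_proposal I' = Some M' \<and>
           hospitals_of M r = {h} \<and> hospitals_of M' r = {h'} \<and> (h, h') \<in> res_pref I r"
proof -
  have "hrt_mslq I'"
    using assms by (simp add: hrt_mslq_def residents_def hospitals_def)
  then interpret I': hrt I' by unfold_locales
  interpret hrt I using assms(1) by unfold_locales
  have "r \<in> residents I'" using assms(2,4) by (simp add: residents_def)
  then obtain M M' h h' k k' where M: "double_proposal I = Some M" "hospitals_of M r = {h}"
      and x: "(r, h, k) \<in> held I (offers_made I (contracts I))"
      and M': "double_proposal I' = Some M'" "hospitals_of M' r = {h'}"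
      and y: "(r, h', k') \<in> held I' (offers_made I' (contracts I'))"
    using double_proposal_run I'.double_proposal_run assms(2) by metis
  have "\<not> better I (r, h', k') (r, h, k)"
    by (rule strategyproof_offers[OF assms(4) x _ y]) simp_all
  moreover have "(r, h, k) \<in> contracts I" "(r, h', k') \<in> contracts I'"
    using x y offers_made_subset I'.offers_made_subset unfolding held_def by blast+
  then have "h \<in> hospitals I" "h' \<in> hospitals I"
    using assms(4) by (simp_all add: contracts_def hospitals_def)
  \<comment> \<open>Otherwise totality makes \<open>h'\<close> strictly preferred, and then its
    contract is better whatever the rounds \<open>k\<close> and \<open>k'\<close>.\<close>
  ultimately have "(h, h') \<in> res_pref I r"
    using res_pref_total[OF assms(2), of h h'] by (auto simp: better_def)
  then show ?thesis using M M' by blast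
qed

end
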